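(* Let $x^0=0$, $R_{\mathrm d}>1$, and assume that either $f$ is simple (convention: $L_f=0$) or $\mathrm{dom} f=\mathbb{R}^n$ and $\nabla f$ is Lipschitz continuous with constant $L_f>0$. Then for all sufficiently small $\epsilon>0$ the following holds. Set $$\mu=\frac{16R_{\mathrm d}^2}{\epsilon},\qquad\delta=\frac{\epsilon}{24},\qquad L_{\mathrm d}=\frac1\mu .$$ Let $(x^k,y^k)$ be generated by the inexact fast gradient augmented Lagrangian method: $y^1=x^0$, $\theta_0=0$, $\theta_1=1$, $\theta_{k+1}=\frac{1+\sqrt{1+4\theta_k^2}}2$ for $k\ge1$, and for $k\ge1$ $$x^k=y^k+\frac1{2L_{\mathrm d}}\nabla_x\mathcal{L}^{\mathrm{ag}}_\mu(u^k,y^k),\qquad y^{k+1}=x^k+\frac{\theta_k-1}{\theta_{k+1}}(x^k-x^{k-1}),$$ where at each outer iteration $k$ the inner accelerated method described in the context is called to obtain $u^k=u_\mu(y^k)\in U$ with $\mathcal{L}^{\mathrm{ag}}_\mu(u^k,y^k)-d^{\mathrm{ag}}_\mu(y^k)\le\delta$. Let $\hat{u}^k=\frac1{S_k^\theta}\sum_{i=1}^{k-1}\theta_iu^i$ with $S_k^\theta=\sum_{i=1}^{k-1}\theta_i$, $k\ge2$. Then there is $k\ge2$ such that $\hat{u}^k$ is $\epsilon$-optimal, i.e. $$|f(\hat{u}^k)-f^*|\le\epsilon\quad\text{and}\quad\mathrm{dist}_{\mathcal{K}}(G\hat{u}^k+g)\le\epsilon,$$ and such that the total number of projections onto $\mathcal{K}\times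 U$ (inner iterations) performed to compute $u^1,\dots,u^{k-1}$ is at most $$\left\lceil\frac{14L_f^{1/2}D_U}{\epsilon^{1/2}}+\frac{56R_{\mathrm d}\|G\|D_U}{\epsilon}\right\rceil .$$
   Context: Setting. Consider $f^*=\min_{u\in U} f(u)$ s.t. $Gu+g\in\mathcal{K}$, where $f:\mathbb{R}^n\to\mathbb{R}\cup\{+\infty\}$ is proper, closed and convex, $U\subseteq\mathrm{dom} f$ is nonempty, closed, convex and bounded with $\max_{u,v\in U}\|u-v\|\le D_U<\infty$, $G\in\mathbb{R}^{m\times n}$ is nonzero, $g\in\mathbb{R}^m$, and $\mathcal{K}\subseteq\mathbb{R}^m$ is a nonempty closed convex cone with polar cone $\mathcal{K}^*=\{v:\langle v,\kappa\rangle\le0\ \forall\kappa\in\mathcal{K}\}$. It is assumed that there is a Lagrange multiplier $x^*\in\mathcal{K}^*$ closing the duality gap, i.e. $f^*=d(x^* )$, where $d(x)=\min_{u\in U,s\in\mathcal{K}}f(u)+\langle x,Gu+g-s\rangle$. $R_{\mathrm d}=\|x^0-x^*\|$ $(=\|x^*\|$ since $x^0=0)$ for an optimal multiplier $x^*$ (a maximizer of $d$). Projections onto $U$, $\mathcal{K}$, $\mathcal{K}^*$ are computable. $f$ is called simple if $\min_{u\in U}f(u)+\frac1{2\tau}\|u-z\|^2$ can be solved efficiently (exactly) for all $\tau>0$, $z\in\mathbb{R}^n$. Norms are Euclidean ($\|G\|$ is the spectral norm), $[v]_{\mathcal{K}}$ is the projection of $v$ onto $\mathcal{K}$ and $\mathrm{dist}_{\mathcal{K}}(v)=\|v-[v]_{\mathcal{K}}\|$.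 $\mathcal{L}^{\mathrm{ag}}_\mu(u,x)=f(u)+\frac\mu2\,\mathrm{dist}_{\mathcal{K}}\left(Gu+g+\frac1\mu x\right)^2-\frac1{2\mu}\|x\|^2$, $d^{\mathrm{ag}}_\mu(x)=\min_{u\in U}\mathcal{L}^{\mathrm{ag}}_\mu(u,x)$, $\nabla_x\mathcal{L}^{\mathrm{ag}}_\mu(u,x)=Gu+g-\left[Gu+g+\frac1\mu x\right]_{\mathcal{K}}$. Inner method for fixed $x$. Write $\mathcal{L}^{\mathrm{ag}}_\mu(\cdot,x)=\phi+\psi$ up to an additive constant, where if $f$ is simple, $\phi(u)=\frac\mu2\mathrm{dist}_{\mathcal{K}}(Gu+g+\frac1\mu x)^2$, $\psi=f$, $L=\mu\|G\|^2$; otherwise $\phi=\mathcal{L}^{\mathrm{ag}}_\mu(\cdot,x)$, $\psi=0$, $L=L_f+\mu\|G\|^2$. Starting from $z^0=w^1\in U$, $t_1=1$, for $j\ge1$: $z^j=\arg\min_{z\in U}\langle\nabla\phi(w^j),z-w^j\rangle+\frac L2\|z-w^j\|^2+\psi(z)$, $t_{j+1}=\frac{1+\sqrt{1+4t_j^2}}2$, $w^{j+1}=z^j+\frac{t_j-1}{t_{j+1}}(z^j-z^{j-1})$. It is stopped at the first iterate $z^j$, $j\ge0$, with $\mathcal{L}^{\mathrm{ag}}_\mu(z^j,x)-d^{\mathrm{ag}}_\mu(x)\le\delta$, which is returned as $u_\mu(x)$. Each inner iteration counts as one projection onto $\mathcal{K}\times U$. *)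

theory Defs
  imports "HOL-Analysis.Analysis"
begin

section \<open>Convex analysis\<close>

definition effective_domain :: "('a \<Rightarrow> ereal) \<Rightarrow> 'a set" where
  "effective_domain f = {u. f u < \<infinity>}"

text \<open>Not the library's \<open>epigraph\<close>, which is restricted to real-valued functions on a set.\<close>

definition ereal_epigraph :: "('a \<Rightarrow> ereal) \<Rightarrow> ('a \<times> real) set" where
  "ereal_epigraph f = {(u, t). f u \<le> ereal t}"

definition proper_closed_convex :: "('a::real_normed_vector \<Rightarrow> ereal) \<Rightarrow> bool" where
  "proper_closed_convex f \<longleftrightarrow>
     (\<forall>u. f u \<noteq> -\<infinity>) \<and> effective_domain f \<noteq> {} \<and>
     closed (ereal_epigraph f) \<and> convex (ereal_epigraph f)"

definition polar_cone :: "'a::real_inner set \<Rightarrow> 'a set" where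
  "polar_cone K = {v. \<forall>\<kappa>\<in>K. inner v \<kappa> \<le> 0}"

definition proj_dist :: "'a::euclidean_space set \<Rightarrow> 'a \<Rightarrow> real" where
  "proj_dist K v = norm (v - closest_point K v)"

definition gradient :: "('a::real_inner \<Rightarrow> real) \<Rightarrow> 'a \<Rightarrow> 'a" where
  "gradient h u = (THE D. GDERIV h u :> D)"

text \<open>The two admissible classes of objectives. ``Simple'' means that the proximal subproblem on
  \<open>U\<close> can be solved exactly for all parameters; the requirement that this be done efficiently is
  not a mathematical condition on \<open>f\<close> and has no counterpart here. (Existence of the minimizer is
  automatic for proper closed convex \<open>f\<close> and nonempty compact convex \<open>U\<close>. Which variant of the inner
  method is run is therefore decided by an explicit flag below, and not by this predicate.)\<close>

definition simple_on :: "'a::real_normed_vector set \<Rightarrow> ('a \<Rightarrow> ereal) \<Rightarrow> bool" where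
  "simple_on U f \<longleftrightarrow>
     (\<forall>\<tau>>0. \<forall>z. \<exists>u. is_arg_min (\<lambda>v. f v + ereal (1 / (2 * \<tau>) * (norm (v - z))\<^sup>2)) (\<lambda>v. v \<in> U) u)"

definition lipschitz_gradient :: "real \<Rightarrow> ('a::real_inner \<Rightarrow> ereal) \<Rightarrow> bool" where
  "lipschitz_gradient L f \<longleftrightarrow>
     (\<forall>u. \<exists>D. GDERIV (\<lambda>v. real_of_ereal (f v)) u :> D) \<and>
     lipschitz_on L UNIV (gradient (\<lambda>v. real_of_ereal (f v)))"


section \<open>The conic problem and its (augmented) Lagrangian dual\<close>

text \<open>All minima are rendered as infima in \<^typ>\<open>ereal\<close>; in particular the dual function is
  \<open>-\<infinity>\<close> outside the polar cone, and the optimal value of an infeasible problem is \<open>\<infinity>\<close>.\<close>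

definition opt_val ::
  "(real^'n \<Rightarrow> ereal) \<Rightarrow> (real^'n) set \<Rightarrow> real^'n^'m \<Rightarrow> real^'m \<Rightarrow> (real^'m) set \<Rightarrow> ereal" where
  "opt_val f U G g K = (INF u\<in>{u \<in> U. G *v u + g \<in> K}. f u)"

definition dual_fun ::
  "(real^'n \<Rightarrow> ereal) \<Rightarrow> (real^'n) set \<Rightarrow> real^'n^'m \<Rightarrow> real^'m \<Rightarrow> (real^'m) set
    \<Rightarrow> real^'m \<Rightarrow> ereal" where
  "dual_fun f U G g K x = (INF (u, s)\<in>U \<times> K. f u + ereal (inner x (G *v u + g - s)))"

definition lagrange_multiplier ::
  "(real^'n \<Rightarrow> ereal) \<Rightarrow> (real^'n) set \<Rightarrow> real^'n^'m \<Rightarrow> real^'m \<Rightarrow> (real^'m) set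
    \<Rightarrow> real^'m \<Rightarrow> bool" where
  "lagrange_multiplier f U G g K x \<longleftrightarrow>
     x \<in> polar_cone K \<and> opt_val f U G g K = dual_fun f U G g K x"

lemma weak_duality: "dual_fun f U G g K x \<le> opt_val f U G g K"
  unfolding opt_val_def
proof (rule INF_greatest)
  fix u assume "u \<in> {u \<in> U. G *v u + g \<in> K}"
  then have "(u, G *v u + g) \<in> U \<times> K" by auto
  then have "dual_fun f U G g K x \<le>
      (case (u, G *v u + g) of (u, s) \<Rightarrow> f u + ereal (inner x (G *v u + g - s)))"
    unfolding dual_fun_def by (rule INF_lower)
  then show "dual_fun f U G g K x \<le> f u" by simp
qed

text \<open>A multiplier closing the duality gap is a maximizer of the dual function.\<close>

lemma lagrange_multiplier_maximizes:
  "lagrange_multiplier f U G g K xs \<Longrightarrow> dual_fun f U G g K x \<le> dual_fun f U G g K xs"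
  using weak_duality[of f U G g K x] by (simp add: lagrange_multiplier_def)

definition aug_penalty ::
  "real^'n^'m \<Rightarrow> real^'m \<Rightarrow> (real^'m) set \<Rightarrow> real \<Rightarrow> real^'m \<Rightarrow> real^'n \<Rightarrow> real" where
  "aug_penalty G g K \<mu> x u = \<mu> / 2 * (proj_dist K (G *v u + g + (1 / \<mu>) *\<^sub>R x))\<^sup>2"

definition aug_lagrangian ::
  "(real^'n \<Rightarrow> ereal) \<Rightarrow> real^'n^'m \<Rightarrow> real^'m \<Rightarrow> (real^'m) set \<Rightarrow> real
    \<Rightarrow> real^'n \<Rightarrow> real^'m \<Rightarrow> ereal" where
  "aug_lagrangian f G g K \<mu> u x =
     f u + ereal (aug_penalty G g K \<mu> x u - 1 / (2 * \<mu>) * (norm x)\<^sup>2)"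

definition aug_dual ::
  "(real^'n \<Rightarrow> ereal) \<Rightarrow> (real^'n) set \<Rightarrow> real^'n^'m \<Rightarrow> real^'m \<Rightarrow> (real^'m) set \<Rightarrow> real
    \<Rightarrow> real^'m \<Rightarrow> ereal" where
  "aug_dual f U G g K \<mu> x = (INF u\<in>U. aug_lagrangian f G g K \<mu> u x)"

text \<open>The gradient of the augmented Lagrangian with respect to the multiplier, in closed form; see
  \<open>GDERIV_aug_lagrangian\<close> below.\<close>

definition aug_grad ::
  "real^'n^'m \<Rightarrow> real^'m \<Rightarrow> (real^'m) set \<Rightarrow> real \<Rightarrow> real^'n \<Rightarrow> real^'m \<Rightarrow> real^'m" where
  "aug_grad G g K \<mu> u x =
     G *v u + g - closest_point K (G *v u + g + (1 / \<mu>) *\<^sub>R x)"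

lemma GDERIV_half_proj_dist_sq:
  fixes K :: "'a::euclidean_space set"
  assumes K: "closed K" "convex K" "K \<noteq> {}"
  shows "GDERIV (\<lambda>v. (proj_dist K v)\<^sup>2 / 2) v :> v - closest_point K v"
proof -
  let ?p = "closest_point K"
  let ?h = "\<lambda>v. (proj_dist K v)\<^sup>2 / 2"
  have le: "?h b \<le> (norm (b - ?p a))\<^sup>2 / 2" for a b
  proof -
    have "dist b (?p b) \<le> dist b (?p a)"
      using K by (intro closest_point_le closest_point_in_set)
    then show ?thesis
      by (simp add: proj_dist_def dist_norm power_mono)
  qed
  have expand: "(norm (b - ?p a))\<^sup>2 / 2 = ?h a + inner (b - a) (a - ?p a) + (norm (b - a))\<^sup>2 / 2" for a b
    unfolding proj_dist_def power2_norm_eq_inner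
    by (simp add: inner_diff_left inner_diff_right inner_commute field_simps)
  have bd: "\<bar>?h b - ?h a - inner (b - a) (a - ?p a)\<bar> \<le> (norm (b - a))\<^sup>2" for a b
  proof -
    have 1: "?h b \<le> ?h a + inner (b - a) (a - ?p a) + (norm (b - a))\<^sup>2 / 2"
      using le[of b a] expand[of b a] by simp
    have 2: "?h a \<le> ?h b + inner (a - b) (b - ?p b) + (norm (a - b))\<^sup>2 / 2"
      using le[of a b] expand[of a b] by simp
    have "inner (b - a) (?p b - ?p a) \<le> norm (b - a) * norm (?p b - ?p a)"
      by (rule norm_cauchy_schwarz)
    also have "\<dots> \<le> norm (b - a) * norm (b - a)"
      using closest_point_lipschitz[of K b a] K by (intro mult_left_mono) (auto simp: dist_norm)
    finally have 3: "inner (b - a) (?p b - ?p a) \<le> (norm (b - a))\<^sup>2"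
      by (simp add: power2_eq_square)
    have 4: "inner (a - b) (b - ?p b) =
        - inner (b - a) (a - ?p a) - (norm (b - a))\<^sup>2 + inner (b - a) (?p b - ?p a)"
      unfolding power2_norm_eq_inner
      by (simp add: inner_diff_left inner_diff_right inner_commute)
    have 5: "(norm (a - b))\<^sup>2 = (norm (b - a))\<^sup>2" by (simp add: norm_minus_commute)
    show ?thesis using 1 2 3 4 5 zero_le_power2[of "norm (b - a)"] by linarith
  qed
  show ?thesis
    unfolding gderiv_def has_derivative_at_within
  proof (intro conjI bounded_linear_inner_left)
    show "((\<lambda>y. (?h y - ?h v - inner (y - v) (v - ?p v)) /\<^sub>R norm (y - v)) \<longlongrightarrow> 0) (at v)"
    proof (rule Lim_null_comparison)
      show "\<forall>\<^sub>F y in at v. norm ((?h y - ?h v - inner (y - v) (v - ?p v)) /\<^sub>R norm (y - v))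
          \<le> norm (y - v)"
      proof (rule always_eventually, rule allI)
        fix y
        show "norm ((?h y - ?h v - inner (y - v) (v - ?p v)) /\<^sub>R norm (y - v)) \<le> norm (y - v)"
        proof (cases "y = v")
          case False
          have "\<bar>?h y - ?h v - inner (y - v) (v - ?p v)\<bar> \<le> norm (y - v) * norm (y - v)"
            using bd[of y v] by (simp add: power2_eq_square algebra_simps)
          with False show ?thesis by (simp add: field_simps)
        qed simp
      qed
      show "((\<lambda>y. norm (y - v)) \<longlongrightarrow> 0) (at v)"
        by (intro tendsto_eq_intros | simp)+
    qed
  qed
qed

lemma GDERIV_aug_lagrangian:
  fixes K :: "(real^'m) set"
  assumes K: "closed K" "convex K" "K \<noteq> {}" and "\<mu> > 0" and fu: "\<bar>f u\<bar> \<noteq> \<infinity>"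
  shows "GDERIV (\<lambda>x. real_of_ereal (aug_lagrangian f G g K \<mu> u x)) x :> aug_grad G g K \<mu> u x"
proof -
  let ?b = "G *v u + g"
  let ?v = "\<lambda>x. ?b + (1 / \<mu>) *\<^sub>R x"
  obtain r where r: "f u = ereal r" using fu by (cases "f u") auto
  have eq: "(\<lambda>x. real_of_ereal (aug_lagrangian f G g K \<mu> u x)) =
      (\<lambda>x. r + \<mu> * ((proj_dist K (?v x))\<^sup>2 / 2) - 1 / (2 * \<mu>) * inner x x)"
    by (auto simp: aug_lagrangian_def aug_penalty_def r power2_norm_eq_inner)
  have *: "((\<lambda>v. (proj_dist K v)\<^sup>2 / 2) has_derivative
      (\<lambda>h. inner h (?v x - closest_point K (?v x)))) (at (?v x))"
    using GDERIV_half_proj_dist_sq[OF K, of "?v x"] unfolding gderiv_def .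
  have v: "(?v has_derivative (\<lambda>h. (1 / \<mu>) *\<^sub>R h)) (at x)"
    by (auto intro!: derivative_eq_intros)
  have c: "((\<lambda>x. (proj_dist K (?v x))\<^sup>2 / 2) has_derivative
      (\<lambda>h. inner ((1 / \<mu>) *\<^sub>R h) (?v x - closest_point K (?v x)))) (at x)"
    by (rule has_derivative_compose[OF v *])
  have "((\<lambda>x. r + \<mu> * ((proj_dist K (?v x))\<^sup>2 / 2) - 1 / (2 * \<mu>) * inner x x) has_derivative
      (\<lambda>h. 0 + \<mu> * inner ((1 / \<mu>) *\<^sub>R h) (?v x - closest_point K (?v x))
        - 1 / (2 * \<mu>) * (inner x h + inner h x))) (at x)"
    by (intro has_derivative_diff has_derivative_add has_derivative_const has_derivative_mult_right
        c has_derivative_inner has_derivative_ident)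
  moreover have "(\<lambda>h. 0 + \<mu> * inner ((1 / \<mu>) *\<^sub>R h) (?v x - closest_point K (?v x))
        - 1 / (2 * \<mu>) * (inner x h + inner h x)) = (\<lambda>h. inner h (aug_grad G g K \<mu> u x))"
    using \<open>\<mu> > 0\<close>
    by (auto simp: aug_grad_def inner_diff_right inner_add_right inner_commute field_simps)
  ultimately show ?thesis
    unfolding eq gderiv_def by simp
qed


section \<open>The accelerated methods\<close>

text \<open>Both step sequences coincide: the recursion started at 0 gives the value 1 at index 1, so
  \<open>fista_seq k\<close> is \<open>\<theta>\<^sub>k\<close> for \<open>k \<ge> 0\<close> and \<open>t\<^sub>k\<close> for \<open>k \<ge> 1\<close>.\<close>

fun fista_seq :: "nat \<Rightarrow> real" where
  "fista_seq 0 = 0"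
| "fista_seq (Suc k) = (1 + sqrt (1 + 4 * (fista_seq k)\<^sup>2)) / 2"

lemma fista_seq_1: "fista_seq 1 = 1"
  by simp

text \<open>A run of the accelerated method from \<open>z 0 \<in> U\<close>; index 0 of \<open>w\<close> is unused.\<close>

definition accelerated_run ::
  "('a::real_inner) set \<Rightarrow> ('a \<Rightarrow> real) \<Rightarrow> ('a \<Rightarrow> ereal) \<Rightarrow> real \<Rightarrow> (nat \<Rightarrow> 'a) \<Rightarrow> (nat \<Rightarrow> 'a) \<Rightarrow> bool"
where
  "accelerated_run U \<phi> \<psi> L z w \<longleftrightarrow>
     z 0 \<in> U \<and> w 1 = z 0 \<and>
     (\<forall>j\<ge>1.
        is_arg_min
          (\<lambda>v. ereal (inner (gradient \<phi> (w j)) (v - w j) + L / 2 * (norm (v - w j))\<^sup>2) + \<psi> v)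
          (\<lambda>v. v \<in> U) (z j) \<and>
        w (Suc j) = z j + ((fista_seq j - 1) / fista_seq (Suc j)) *\<^sub>R (z j - z (j - 1)))"

text \<open>The splitting of the augmented Lagrangian at a fixed multiplier \<open>x\<close>. The flag \<open>simple\<close> says
  whether \<open>f\<close> is treated as simple.\<close>

definition inner_run ::
  "bool \<Rightarrow> real \<Rightarrow> (real^'n \<Rightarrow> ereal) \<Rightarrow> (real^'n) set \<Rightarrow> real^'n^'m \<Rightarrow> real^'m \<Rightarrow> (real^'m) set
    \<Rightarrow> real \<Rightarrow> real^'m \<Rightarrow> (nat \<Rightarrow> real^'n) \<Rightarrow> (nat \<Rightarrow> real^'n) \<Rightarrow> bool" where
  "inner_run simple Lf f U G g K \<mu> x z w \<longleftrightarrow>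
     (if simple
      then accelerated_run U (aug_penalty G g K \<mu> x) f (\<mu> * (onorm ((*v) G))\<^sup>2) z w
      else accelerated_run U (\<lambda>u. real_of_ereal (aug_lagrangian f G g K \<mu> u x)) (\<lambda>_. 0)
             (Lf + \<mu> * (onorm ((*v) G))\<^sup>2) z w)"

definition inner_accepts ::
  "(real^'n \<Rightarrow> ereal) \<Rightarrow> (real^'n) set \<Rightarrow> real^'n^'m \<Rightarrow> real^'m \<Rightarrow> (real^'m) set \<Rightarrow> real \<Rightarrow> real
    \<Rightarrow> real^'m \<Rightarrow> real^'n \<Rightarrow> bool" where
  "inner_accepts f U G g K \<mu> \<delta> x v \<longleftrightarrow>
     aug_lagrangian f G g K \<mu> v x - aug_dual f U G g K \<mu> x \<le> ereal \<delta>"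

text \<open>The index of the first acceptable iterate, which is also the number of inner iterations, i.e.
  of projections onto \<open>K \<times> U\<close>. It is meaningful only if some iterate is acceptable; that the inner
  method stops is not assumed, but has to be stated wherever this number is used.\<close>

definition inner_count ::
  "(real^'n \<Rightarrow> ereal) \<Rightarrow> (real^'n) set \<Rightarrow> real^'n^'m \<Rightarrow> real^'m \<Rightarrow> (real^'m) set \<Rightarrow> real \<Rightarrow> real
    \<Rightarrow> real^'m \<Rightarrow> (nat \<Rightarrow> real^'n) \<Rightarrow> nat" where
  "inner_count f U G g K \<mu> \<delta> x z = (LEAST j. inner_accepts f U G g K \<mu> \<delta> x (z j))"

text \<open>A run of the outer method. \<open>z k\<close> and \<open>w k\<close> are the inner iterates of outer iteration \<open>k\<close>, whose
  starting point \<open>z k 0 \<in> U\<close> is arbitrary. Inner runs are recorded beyond their stopping index, but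
  only the iterate at that index enters the outer iteration.\<close>

definition outer_run ::
  "bool \<Rightarrow> real \<Rightarrow> (real^'n \<Rightarrow> ereal) \<Rightarrow> (real^'n) set \<Rightarrow> real^'n^'m \<Rightarrow> real^'m \<Rightarrow> (real^'m) set
    \<Rightarrow> real \<Rightarrow> real \<Rightarrow> real
    \<Rightarrow> (nat \<Rightarrow> real^'m) \<Rightarrow> (nat \<Rightarrow> real^'m) \<Rightarrow> (nat \<Rightarrow> real^'n)
    \<Rightarrow> (nat \<Rightarrow> nat \<Rightarrow> real^'n) \<Rightarrow> (nat \<Rightarrow> nat \<Rightarrow> real^'n) \<Rightarrow> bool" where
  "outer_run simple Lf f U G g K \<mu> \<delta> Ld x y u z w \<longleftrightarrow>
     x 0 = 0 \<and> y 1 = x 0 \<and>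
     (\<forall>k\<ge>1.
        inner_run simple Lf f U G g K \<mu> (y k) (z k) (w k) \<and>
        u k = z k (inner_count f U G g K \<mu> \<delta> (y k) (z k)) \<and>
        x k = y k + (1 / (2 * Ld)) *\<^sub>R aug_grad G g K \<mu> (u k) (y k) \<and>
        y (Suc k) = x k + ((fista_seq k - 1) / fista_seq (Suc k)) *\<^sub>R (x k - x (k - 1)))"

definition weighted_avg :: "(nat \<Rightarrow> 'a::real_vector) \<Rightarrow> nat \<Rightarrow> 'a" where
  "weighted_avg u k =
     (1 / (\<Sum>i=1..k-1. fista_seq i)) *\<^sub>R (\<Sum>i=1..k-1. fista_seq i *\<^sub>R u i)"

end

theory Submission
  imports Defs
begin

text \<open>One outer iteration suffices. At \<open>y\<^sup>1 = 0\<close> the augmented Lagrangian is \<open>f\<close> plus the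
  quadratic penalty \<open>(\<mu>/2) q\<^sup>2\<close> with \<open>q = dist\<^sub>K(Gu + g)\<close>, so a \<open>\<delta>\<close>-minimizer \<open>u\<close> satisfies
  \<open>f(u) + (\<mu>/2) q\<^sup>2 \<le> f\<^sup>* + \<delta>\<close>, while the multiplier gives \<open>f\<^sup>* \<le> f(u) + R\<^sub>d q\<close>. For the prescribed
  \<open>\<mu>\<close> and \<open>\<delta>\<close> these two inequalities force \<open>R\<^sub>d q \<le> \<epsilon>\<close>, hence \<open>\<epsilon>\<close>-optimality of \<open>u = u\<^sup>1\<close>. The cost
  of the single inner run follows from the \<open>O(1/j\<^sup>2)\<close> rate of the accelerated method, which gives
  acceptance once \<open>j \<ge> D\<^sub>U (2L/\<delta>)\<^sup>1\<^sup>/\<^sup>2\<close>; for \<open>D\<^sub>U = 0\<close> the starting point is already optimal.\<close>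

section \<open>Gradients and quadratic bounds\<close>

text \<open>\<open>gradient\<close> is a definite description, so uniqueness is what has to be
  shown: two candidates represent the same derivative, and evaluating it at \<open>D' - D\<close>
  makes the norm of that difference vanish.\<close>

lemma gradient_eqI:
  assumes "GDERIV h u :> D"
  shows "gradient h u = D"
  unfolding gradient_def using assms
proof (rule the_equality)
  fix D' assume "GDERIV h u :> D'"
  then have "(\<lambda>x. inner x D') = (\<lambda>x. inner x D)"
    using assms unfolding gderiv_def by (rule has_derivative_unique)
  then have "inner (D' - D) D' = inner (D' - D) D" by meson
  then have "inner (D' - D) (D' - D) = 0" by (subst inner_diff_right) simp
  then show "D' = D" by simp
qed

text \<open>The lower bound is convexity in supporting-hyperplane form, the upper one the descent
  inequality. With the gradient field \<open>D\<close> as an argument, sums and affine substitutions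
  can be treated without evaluating a definite description.\<close>

definition smooth_convex :: "('a::real_inner \<Rightarrow> real) \<Rightarrow> ('a \<Rightarrow> 'a) \<Rightarrow> real \<Rightarrow> bool" where
  "smooth_convex h D L \<longleftrightarrow>
     (\<forall>a. GDERIV h a :> D a) \<and>
     (\<forall>a b. h a + inner (D a) (b - a) \<le> h b \<and>
            h b \<le> h a + inner (D a) (b - a) + L / 2 * (norm (b - a))\<^sup>2)"

lemma smooth_convex_gradient: "smooth_convex h D L \<Longrightarrow> gradient h = D"
  unfolding smooth_convex_def by (auto intro: gradient_eqI)

lemma smooth_convex_add:
  assumes "smooth_convex h D L" "smooth_convex h' D' L'"
  shows "smooth_convex (\<lambda>u. h u + h' u) (\<lambda>u. D u + D' u) (L + L')"
  unfolding smooth_convex_def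
proof (intro conjI allI)
  fix a b
  show "GDERIV (\<lambda>u. h u + h' u) a :> D a + D' a"
    using assms by (intro GDERIV_add) (auto simp: smooth_convex_def)
  have "h a + inner (D a) (b - a) \<le> h b" "h' a + inner (D' a) (b - a) \<le> h' b"
    using assms by (auto simp: smooth_convex_def)
  then show "h a + h' a + inner (D a + D' a) (b - a) \<le> h b + h' b"
    by (simp add: inner_add_left)
  have "h b \<le> h a + inner (D a) (b - a) + L / 2 * (norm (b - a))\<^sup>2"
    "h' b \<le> h' a + inner (D' a) (b - a) + L' / 2 * (norm (b - a))\<^sup>2"
    using assms by (auto simp: smooth_convex_def)
  then show "h b + h' b \<le> h a + h' a + inner (D a + D' a) (b - a) + (L + L') / 2 * (norm (b - a))\<^sup>2"
    by (simp add: inner_add_left algebra_simps add_divide_distrib)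
qed

lemma smooth_convex_add_const:
  assumes "smooth_convex h D L"
  shows "smooth_convex (\<lambda>u. h u + c) D L"
proof -
  have "smooth_convex (\<lambda>u. c) (\<lambda>u. 0) 0"
    by (auto simp: smooth_convex_def intro: GDERIV_const)
  from smooth_convex_add[OF assms this] show ?thesis by simp
qed

text \<open>The tangent at the intermediate point lies below \<open>h\<close> at both ends; in the
  weighted sum the linear terms cancel.\<close>

lemma smooth_convex_convex_on:
  fixes h :: "'a::real_inner \<Rightarrow> real"
  assumes "smooth_convex h D L" "convex S"
  shows "convex_on S h"
proof (rule convex_onI)
  fix t :: real and x y :: 'a assume t: "0 < t" "t < 1"
  define c where "c = (1 - t) *\<^sub>R x + t *\<^sub>R y"
  have "h c + inner (D c) (x - c) \<le> h x" "h c + inner (D c) (y - c) \<le> h y"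
    using assms by (auto simp: smooth_convex_def)
  then have "(1 - t) * (h c + inner (D c) (x - c)) + t * (h c + inner (D c) (y - c))
      \<le> (1 - t) * h x + t * h y"
    using t by (intro add_mono mult_left_mono) auto
  moreover have "(1 - t) * inner (D c) (x - c) + t * inner (D c) (y - c) = 0"
  proof -
    have "(1 - t) *\<^sub>R (x - c) + t *\<^sub>R (y - c) = 0"
      by (simp add: c_def algebra_simps)
    then have "inner (D c) ((1 - t) *\<^sub>R (x - c) + t *\<^sub>R (y - c)) = 0" by simp
    then show ?thesis by (simp only: inner_add_right inner_scaleR_right)
  qed
  ultimately have "h c \<le> (1 - t) * h x + t * h y"
    by (simp add: algebra_simps)
  then show "h ((1 - t) *\<^sub>R x + t *\<^sub>R y) \<le> (1 - t) * h x + t * h y"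
    by (simp only: c_def)
qed (fact assms(2))

text \<open>Both bounds are one-dimensional facts along the segment from \<open>a\<close> to
  \<open>b\<close>: the tangent inequality of a convex function, and monotonicity after subtracting
  the quadratic model.\<close>

lemma smooth_convex_lipschitz_gradient:
  fixes h :: "'a::real_inner \<Rightarrow> real"
  assumes diff: "\<And>a. GDERIV h a :> D a" and lip: "L-lipschitz_on UNIV D"
    and conv: "convex_on UNIV h"
  shows "smooth_convex h D L"
  unfolding smooth_convex_def
proof (intro conjI allI)
  fix a b :: 'a
  show "GDERIV h a :> D a" by (rule diff)
  let ?d = "b - a"
  let ?l = "\<lambda>t::real. a + t *\<^sub>R ?d"
  have der: "((\<lambda>t. h (?l t)) has_real_derivative inner (D (?l t)) ?d) (at t)" for t
  proof -
    have "(?l has_derivative (\<lambda>s. s *\<^sub>R ?d)) (at t)"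
      by (auto intro!: derivative_eq_intros)
    from has_derivative_compose[OF this diff[unfolded gderiv_def, of "?l t"]]
    show ?thesis
      by (simp add: has_field_derivative_def inner_commute mult_commute_abs)
  qed
  show "h a + inner (D a) ?d \<le> h b"
  proof -
    have "convex_on UNIV (\<lambda>t. h (?l t))"
    proof (rule convex_onI)
      fix t s r :: real assume t: "0 < t" "t < 1"
      have "?l ((1 - t) *\<^sub>R s + t *\<^sub>R r) = (1 - t) *\<^sub>R ?l s + t *\<^sub>R ?l r"
        by (simp add: algebra_simps)
      then show "h (?l ((1 - t) *\<^sub>R s + t *\<^sub>R r)) \<le> (1 - t) * h (?l s) + t * h (?l r)"
        using convex_onD[OF conv, of t "?l s" "?l r"] t by simp
    qed simp
    from convex_on_imp_above_tangent[OF this _ _ _ der[of 0], of 1] show ?thesis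
      by simp
  qed
  \<comment> \<open>The claim is \<open>q 1 \<le> q 0\<close>. The gradient differs from
    \<open>D a\<close> by at most \<open>L * t * norm ?d\<close> at parameter \<open>t\<close>,
    which makes the derivative of \<open>q\<close> nonpositive on the unit interval.\<close>
  define q where "q = (\<lambda>t. h (?l t) - (t * inner (D a) ?d + L / 2 * t\<^sup>2 * (norm ?d)\<^sup>2))"
  have "q 1 \<le> q 0"
  proof (rule DERIV_nonpos_imp_nonincreasing[where f = q and a = 0 and b = 1])
    fix t :: real assume t: "0 \<le> t" "t \<le> 1"
    have "(q has_real_derivative inner (D (?l t)) ?d - (inner (D a) ?d + L * t * (norm ?d)\<^sup>2)) (at t)"
      unfolding q_def by (rule derivative_eq_intros der refl | simp)+
    moreover have "inner (D (?l t)) ?d - (inner (D a) ?d + L * t * (norm ?d)\<^sup>2) \<le> 0"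
    proof -
      have "inner (D (?l t) - D a) ?d \<le> norm (D (?l t) - D a) * norm ?d"
        by (rule norm_cauchy_schwarz)
      also have "\<dots> \<le> (L * norm (t *\<^sub>R ?d)) * norm ?d"
        using lipschitz_onD[OF lip, of "?l t" a] by (intro mult_right_mono) (auto simp: dist_norm)
      also have "\<dots> = L * t * (norm ?d)\<^sup>2"
        using t by (simp add: power2_eq_square)
      finally show ?thesis by (simp add: inner_diff_left)
    qed
    ultimately show "\<exists>y. DERIV q t :> y \<and> y \<le> 0" by blast
  qed simp
  then show "h b \<le> h a + inner (D a) ?d + L / 2 * (norm ?d)\<^sup>2"
    by (simp add: q_def)
qed

section \<open>Squared distance to a convex set and the augmented penalty\<close>

text \<open>Below: the linearization error is half a square minus the obtuse-angle term of the
  projection of \<open>a\<close>. Above: the projection of \<open>a\<close> competes with that of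
  \<open>b\<close>, which produces the constant 1.\<close>

lemma smooth_convex_half_proj_dist_sq:
  fixes K :: "'a::euclidean_space set"
  assumes K: "closed K" "convex K" "K \<noteq> {}"
  shows "smooth_convex (\<lambda>v. (proj_dist K v)\<^sup>2 / 2) (\<lambda>v. v - closest_point K v) 1"
  unfolding smooth_convex_def
proof (intro conjI allI)
  fix a b
  let ?p = "closest_point K"
  show "GDERIV (\<lambda>v. (proj_dist K v)\<^sup>2 / 2) a :> a - ?p a"
    by (rule GDERIV_half_proj_dist_sq[OF K])
  have "inner (a - ?p a) (?p b - ?p a) \<le> 0"
    using K by (intro closest_point_dot closest_point_in_set)
  moreover have "(norm (b - ?p b))\<^sup>2 / 2 - (norm (a - ?p a))\<^sup>2 / 2 - inner (a - ?p a) (b - a) =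
      (norm ((b - ?p b) - (a - ?p a)))\<^sup>2 / 2 - inner (a - ?p a) (?p b - ?p a)"
    unfolding power2_norm_eq_inner
    by (simp add: inner_diff_left inner_diff_right inner_add_left inner_add_right inner_commute
        field_simps)
  ultimately show "(proj_dist K a)\<^sup>2 / 2 + inner (a - ?p a) (b - a) \<le> (proj_dist K b)\<^sup>2 / 2"
    unfolding proj_dist_def
    using zero_le_power2[of "norm ((b - ?p b) - (a - ?p a))"] by linarith
  have "dist b (?p b) \<le> dist b (?p a)"
    using K by (intro closest_point_le closest_point_in_set)
  then have "(norm (b - ?p b))\<^sup>2 \<le> (norm (b - ?p a))\<^sup>2"
    by (simp add: dist_norm power_mono)
  moreover have "(norm (b - ?p a))\<^sup>2 / 2 =
      (norm (a - ?p a))\<^sup>2 / 2 + inner (a - ?p a) (b - a) + (norm (b - a))\<^sup>2 / 2"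
    unfolding power2_norm_eq_inner
    by (simp add: inner_diff_left inner_diff_right inner_add_left inner_add_right inner_commute
        field_simps)
  ultimately show "(proj_dist K b)\<^sup>2 / 2 \<le>
      (proj_dist K a)\<^sup>2 / 2 + inner (a - ?p a) (b - a) + 1 / 2 * (norm (b - a))\<^sup>2"
    unfolding proj_dist_def by linarith
qed

text \<open>The chain rule moves the gradient through the adjoint \<open>v* G\<close>. The spectral
  norm enters squared since it bounds the increment of the affine map inside the quadratic
  term.\<close>

lemma smooth_convex_affine:
  fixes G :: "real^'n^'m" and h :: "real^'m \<Rightarrow> real"
  assumes h: "smooth_convex h D L" and "L \<ge> 0" "\<mu> \<ge> 0"
  shows "smooth_convex (\<lambda>u. \<mu> * h (G *v u + c)) (\<lambda>u. \<mu> *\<^sub>R (D (G *v u + c) v* G))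
           (\<mu> * (L * (onorm ((*v) G))\<^sup>2))"
  unfolding smooth_convex_def
proof (intro conjI allI)
  have adj: "inner (r v* G) d = inner r (G *v d)" for r d
    by (simp add: dot_lmul_matrix)
  fix a b
  let ?A = "\<lambda>u. G *v u + c"
  have "(?A has_derivative (*v) G) (at a)"
    using has_derivative_add_const[OF bounded_linear_imp_has_derivative[OF matrix_vector_mul_bounded_linear]]
    by blast
  moreover have "(h has_derivative (\<lambda>d. inner d (D (?A a)))) (at (?A a))"
    using h by (simp add: smooth_convex_def gderiv_def)
  ultimately have "((\<lambda>u. h (?A u)) has_derivative (\<lambda>d. inner (G *v d) (D (?A a)))) (at a)"
    by (rule has_derivative_compose)
  from has_derivative_mult_right[OF this, of \<mu>]
  show "GDERIV (\<lambda>u. \<mu> * h (?A u)) a :> \<mu> *\<^sub>R (D (?A a) v* G)"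
    unfolding gderiv_def by (simp add: inner_commute[of _ "_ v* G"] adj inner_commute[of "D _"])
  have diff: "?A b - ?A a = G *v (b - a)"
    by (simp add: matrix_vector_mult_diff_distrib)
  have "h (?A a) + inner (D (?A a)) (?A b - ?A a) \<le> h (?A b)"
    using h unfolding smooth_convex_def by blast
  from mult_left_mono[OF this \<open>\<mu> \<ge> 0\<close>]
  show "\<mu> * h (?A a) + inner (\<mu> *\<^sub>R (D (?A a) v* G)) (b - a) \<le> \<mu> * h (?A b)"
    unfolding diff by (simp add: adj distrib_left)
  have "h (?A b) \<le> h (?A a) + inner (D (?A a)) (?A b - ?A a) + L / 2 * (norm (?A b - ?A a))\<^sup>2"
    using h unfolding smooth_convex_def by blast
  also have "\<dots> \<le> h (?A a) + inner (D (?A a)) (?A b - ?A a)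
      + L / 2 * (onorm ((*v) G) * norm (b - a))\<^sup>2"
    unfolding diff using \<open>L \<ge> 0\<close>
    by (intro add_left_mono mult_left_mono power_mono onorm matrix_vector_mul_bounded_linear) auto
  finally have "\<mu> * h (?A b) \<le> \<mu> * \<dots>"
    using \<open>\<mu> \<ge> 0\<close> by (rule mult_left_mono)
  then show "\<mu> * h (?A b) \<le> \<mu> * h (?A a) + inner (\<mu> *\<^sub>R (D (?A a) v* G)) (b - a) +
       \<mu> * (L * (onorm ((*v) G))\<^sup>2) / 2 * (norm (b - a))\<^sup>2"
    unfolding diff by (simp add: adj algebra_simps power_mult_distrib)
qed

text \<open>This supplies the smoothness constant of the penalty in the inner method.
  \<open>D\<close> is left existential, as \<open>smooth_convex_gradient\<close> identifies it with
  \<open>gradient\<close>.\<close>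

lemma smooth_convex_aug_penalty:
  fixes G :: "real^'n^'m"
  assumes "closed K" "convex K" "K \<noteq> {}" "\<mu> \<ge> 0"
  obtains D where "smooth_convex (aug_penalty G g K \<mu> x) D (\<mu> * (onorm ((*v) G))\<^sup>2)"
proof -
  have "aug_penalty G g K \<mu> x =
      (\<lambda>u. \<mu> * ((proj_dist K (G *v u + (g + (1 / \<mu>) *\<^sub>R x)))\<^sup>2 / 2))"
    by (auto simp: aug_penalty_def add.assoc)
  with smooth_convex_affine[OF smooth_convex_half_proj_dist_sq[OF assms(1-3)] _ assms(4),
      of G "g + (1 / \<mu>) *\<^sub>R x"] that
  show ?thesis by simp
qed


section \<open>The rate of the accelerated method\<close>

text \<open>The recursion picks the larger root of t^2 - t = c, with c the square of the previous
  term. This identity makes the energy of the accelerated method telescope.\<close>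

lemma fista_seq_Suc_sq: "(fista_seq (Suc k))\<^sup>2 - fista_seq (Suc k) = (fista_seq k)\<^sup>2"
proof -
  define s where "s = sqrt (1 + 4 * (fista_seq k)\<^sup>2)"
  have "s\<^sup>2 = 1 + 4 * (fista_seq k)\<^sup>2" by (simp add: s_def)
  moreover have "fista_seq (Suc k) = (1 + s) / 2" by (simp add: s_def)
  ultimately show ?thesis by (simp add: power2_eq_square field_simps)
qed

text \<open>Each step adds at least 1/2 because sqrt(1 + 4 t^2) \<ge> 2 t; the linear growth gives
  the quadratic rate.\<close>

lemma fista_seq_Suc_ge: "fista_seq (Suc k) \<ge> (real k + 2) / 2"
proof (induction k)
  case (Suc k)
  have "2 * fista_seq (Suc k) \<le> sqrt (1 + 4 * (fista_seq (Suc k))\<^sup>2)"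
    by (rule real_le_rsqrt) (simp add: power_mult_distrib del: fista_seq.simps)
  with Suc show ?case unfolding fista_seq.simps(2)[of "Suc k"] by simp
qed simp

text \<open>First-order optimality of a proximal step, obtained without subgradients by comparing
  \<open>z\<close> with points on the segment towards \<open>v\<close>.\<close>

lemma prox_variational_ineq:
  fixes p :: "'a::real_inner \<Rightarrow> real"
  assumes p: "convex_on U p" and U: "z \<in> U" "v \<in> U" and "L \<ge> 0"
    and min: "\<And>v. v \<in> U \<Longrightarrow>
      inner D (z - w) + L / 2 * (norm (z - w))\<^sup>2 + p z
        \<le> inner D (v - w) + L / 2 * (norm (v - w))\<^sup>2 + p v"
  shows "0 \<le> inner D (v - z) + p v - p z + L * inner (z - w) (v - z)" (is "0 \<le> ?c")
proof (rule ccontr)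
  assume "\<not> 0 \<le> ?c"
  then have c: "?c < 0" by simp
  define B where "B = L / 2 * (norm (v - z))\<^sup>2"
  have B: "B \<ge> 0" using \<open>L \<ge> 0\<close> by (simp add: B_def)
  \<comment> \<open>A step short enough for the linear decrease to beat the quadratic term: it turns
    \<open>?c + s * B\<close> into the negative number \<open>- (?c * ?c) / (B - ?c)\<close>. The
    denominator is positive and \<open>s \<le> 1\<close> even if \<open>B = 0\<close>.\<close>
  define s where "s = - ?c / (B - ?c)"
  have s: "0 < s" "s \<le> 1" using c B by (auto simp: s_def field_simps)
  define vs where "vs = (1 - s) *\<^sub>R z + s *\<^sub>R v"
  have "vs \<in> U"
    unfolding vs_def using p U s by (intro convexD) (auto simp: convex_on_def)
  from min[OF this] have 1: "inner D (z - w) + L / 2 * (norm (z - w))\<^sup>2 + p z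
        \<le> inner D (vs - w) + L / 2 * (norm (vs - w))\<^sup>2 + p vs" .
  have 2: "p vs \<le> (1 - s) * p z + s * p v"
    unfolding vs_def using s by (intro convex_onD[OF p] U) auto
  have e: "vs - w = (z - w) + s *\<^sub>R (v - z)" by (simp add: vs_def algebra_simps)
  have 3: "inner D (vs - w) = inner D (z - w) + s * inner D (v - z)"
    by (simp add: e inner_add_right)
  have 4: "(norm (vs - w))\<^sup>2 =
      (norm (z - w))\<^sup>2 + 2 * s * inner (z - w) (v - z) + s\<^sup>2 * (norm (v - z))\<^sup>2"
    unfolding e power2_norm_eq_inner
    by (simp add: inner_add_left inner_add_right inner_commute power2_eq_square algebra_simps)
  have "0 \<le> s * ?c + s\<^sup>2 * B"
    using 1 2 unfolding 3 4 B_def by (simp add: algebra_simps)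
  then have "0 \<le> s * (?c + s * B)" by (simp add: power2_eq_square algebra_simps)
  then have "0 \<le> ?c + s * B" using s by (simp add: zero_le_mult_iff)
  moreover have "?c + s * B = - (?c * ?c) / (B - ?c)"
    using c B by (simp add: s_def field_simps)
  moreover have "- (?c * ?c) / (B - ?c) < 0"
    using c B by (intro divide_neg_pos) (auto intro: mult_neg_neg)
  ultimately show False by linarith
qed

lemma accelerated_run_mem:
  assumes "accelerated_run U \<phi> \<psi> L z w"
  shows "z j \<in> U"
  using assms by (cases j) (auto simp: accelerated_run_def is_arg_min_def)

text \<open>The energy argument for accelerated proximal gradient methods: a weighted objective gap
  plus a squared distance never increases. The comparison point \<open>u\<close> is any point of
  \<open>U\<close>, so no minimizer has to be produced.\<close>

lemma accelerated_run_bound: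
  fixes z :: "nat \<Rightarrow> 'a::real_inner"
  assumes run: "accelerated_run U \<phi> \<psi> L z w"
    and \<phi>: "smooth_convex \<phi> D L" and "L \<ge> 0"
    and \<psi>: "\<And>v. v \<in> U \<Longrightarrow> \<psi> v = ereal (p v)" and p: "convex_on U p"
    and u: "u \<in> U"
  shows "\<phi> (z (Suc j)) + p (z (Suc j))
    \<le> \<phi> u + p u + 2 * L * (norm (z 0 - u))\<^sup>2 / (real j + 2)\<^sup>2"
proof -
  define F where "F v = \<phi> v + p v" for v
  let ?t = fista_seq
  have convU: "convex U" using p by (simp add: convex_on_def)
  have zU: "z i \<in> U" for i using accelerated_run_mem[OF run] .
  have F: "convex_on U F"
    unfolding F_def using smooth_convex_convex_on[OF \<phi> convU] p by (rule convex_on_add)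
  \<comment> \<open>The three-point inequality: prox optimality, convexity of \<phi> at
    \<open>w\<close> and the descent inequality from \<open>w\<close> to \<open>z\<close> add up to
    a difference of squared distances.\<close>
  have step: "F (z (Suc i)) - F v
      \<le> L / 2 * ((norm (w (Suc i) - v))\<^sup>2 - (norm (z (Suc i) - v))\<^sup>2)"
    if v: "v \<in> U" for i v
  proof -
    let ?z = "z (Suc i)" and ?w = "w (Suc i)"
    have am: "is_arg_min
          (\<lambda>v. ereal (inner (D ?w) (v - ?w) + L / 2 * (norm (v - ?w))\<^sup>2) + \<psi> v) (\<lambda>v. v \<in> U) ?z"
      using run smooth_convex_gradient[OF \<phi>] by (simp add: accelerated_run_def)
    have "inner (D ?w) (?z - ?w) + L / 2 * (norm (?z - ?w))\<^sup>2 + p ?z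
        \<le> inner (D ?w) (v - ?w) + L / 2 * (norm (v - ?w))\<^sup>2 + p v" if "v \<in> U" for v
      using am that zU[of "Suc i"] by (auto simp: is_arg_min_def \<psi> not_less)
    from prox_variational_ineq[OF p zU v \<open>L \<ge> 0\<close> this]
    have 1: "0 \<le> inner (D ?w) (v - ?z) + p v - p ?z + L * inner (?z - ?w) (v - ?z)" .
    have 2: "\<phi> ?w + inner (D ?w) (v - ?w) \<le> \<phi> v"
      "\<phi> ?z \<le> \<phi> ?w + inner (D ?w) (?z - ?w) + L / 2 * (norm (?z - ?w))\<^sup>2"
      using \<phi> by (auto simp: smooth_convex_def)
    have 3: "L / 2 * ((norm (?w - v))\<^sup>2 - (norm (?z - v))\<^sup>2) =
        L / 2 * (norm (?z - ?w))\<^sup>2 + L * inner (?z - ?w) (v - ?z)"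
      unfolding power2_norm_eq_inner
      by (simp add: inner_diff_left inner_diff_right inner_add_left inner_add_right inner_commute
        field_simps)
    have 4: "inner (D ?w) (v - ?w) = inner (D ?w) (v - ?z) + inner (D ?w) (?z - ?w)"
      by (simp add: inner_diff_right)
    show ?thesis unfolding F_def using 1 2 3 4 by linarith
  qed
  let ?a = "\<lambda>i. ?t (Suc i) *\<^sub>R z (Suc i) - (?t (Suc i) - 1) *\<^sub>R z i - u"
  have inv: "(?t (Suc i))\<^sup>2 * (F (z (Suc i)) - F u) + L / 2 * (norm (?a i))\<^sup>2
      \<le> L / 2 * (norm (z 0 - u))\<^sup>2" for i
  proof (induction i)
    case 0
    \<comment> \<open>As the first weight is 1, the coefficient of \<open>z 0\<close> in
      \<open>?a 0\<close> vanishes and the claim is a plain three-point inequality.\<close>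
    have "w 1 = z 0" using run by (simp add: accelerated_run_def)
    then show ?case using step[OF u, of 0] by (simp add: right_diff_distrib)
  next
    case (Suc i)
    define s where "s = ?t (Suc (Suc i))"
    have s: "s \<ge> 1" using fista_seq_Suc_ge[of "Suc i"] by (simp add: s_def)
    \<comment> \<open>Comparing with this mixture of the last iterate and \<open>u\<close> is the
      accelerating idea: scaled by \<open>s\<close>, the distances from \<open>w\<close> and from
      the new iterate to \<open>v\<close> become \<open>?a i\<close> and
      \<open>?a (Suc i)\<close>.\<close>
    define v where "v = (1 - 1 / s) *\<^sub>R z (Suc i) + (1 / s) *\<^sub>R u"
    have v: "v \<in> U"
      unfolding v_def using convU zU u s by (intro convexD) auto
    have sv: "s *\<^sub>R v = (s - 1) *\<^sub>R z (Suc i) + u"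
      using s by (simp add: v_def algebra_simps)
    have Fv: "F v \<le> (1 - 1 / s) * F (z (Suc i)) + 1 / s * F u"
      unfolding v_def using s by (intro convex_onD[OF F] zU u) auto
    have "w (Suc (Suc i)) = z (Suc i) + ((?t (Suc i) - 1) / s) *\<^sub>R (z (Suc i) - z i)"
      using run by (simp add: accelerated_run_def s_def del: fista_seq.simps)
    then have "s *\<^sub>R w (Suc (Suc i)) = s *\<^sub>R z (Suc i) + (?t (Suc i) - 1) *\<^sub>R (z (Suc i) - z i)"
      using s by (simp add: scaleR_add_right del: fista_seq.simps)
    then have ai: "s *\<^sub>R (w (Suc (Suc i)) - v) = ?a i"
      by (simp add: scaleR_diff_right sv algebra_simps del: fista_seq.simps)
    have aSi: "s *\<^sub>R (z (Suc (Suc i)) - v) = ?a (Suc i)"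
      by (simp add: scaleR_diff_right sv s_def[symmetric] del: fista_seq.simps)
    have "s\<^sup>2 * (F (z (Suc (Suc i))) - F v)
        \<le> s\<^sup>2 * (L / 2 * ((norm (w (Suc (Suc i)) - v))\<^sup>2 - (norm (z (Suc (Suc i)) - v))\<^sup>2))"
      by (intro mult_left_mono step v) simp
    also have "\<dots> = L / 2 * ((norm (s *\<^sub>R (w (Suc (Suc i)) - v)))\<^sup>2
        - (norm (s *\<^sub>R (z (Suc (Suc i)) - v)))\<^sup>2)"
      unfolding norm_scaleR power_mult_distrib by (simp add: algebra_simps)
    finally have 1: "s\<^sup>2 * (F (z (Suc (Suc i))) - F v)
        \<le> L / 2 * (norm (?a i))\<^sup>2 - L / 2 * (norm (?a (Suc i)))\<^sup>2"
      unfolding ai aSi by (simp only: right_diff_distrib)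
    have "s\<^sup>2 * F v \<le> s\<^sup>2 * ((1 - 1 / s) * F (z (Suc i)) + 1 / s * F u)"
      by (intro mult_left_mono Fv) simp
    also have "\<dots> = (s\<^sup>2 - s) * F (z (Suc i)) + s * F u"
      using s by (simp add: power2_eq_square field_simps)
    finally have 2: "s\<^sup>2 * F v \<le> (s\<^sup>2 - s) * F (z (Suc i)) + s * F u" .
    have 3: "s\<^sup>2 - s = (?t (Suc i))\<^sup>2"
      unfolding s_def by (rule fista_seq_Suc_sq)
    have "s\<^sup>2 * (F (z (Suc (Suc i))) - F u) + L / 2 * (norm (?a (Suc i)))\<^sup>2
        \<le> (s\<^sup>2 - s) * (F (z (Suc i)) - F u) + L / 2 * (norm (?a i))\<^sup>2"
      using 1 2 by (simp add: algebra_simps del: fista_seq.simps)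
    also have "\<dots> \<le> L / 2 * (norm (z 0 - u))\<^sup>2"
      using Suc unfolding 3 .
    finally show ?case unfolding s_def .
  qed
  \<comment> \<open>Replacing the weight by its lower bound (j + 2)/2 requires a nonnegative gap; a
    negative gap is bounded trivially.\<close>
  have "F (z (Suc j)) - F u \<le> 2 * L * (norm (z 0 - u))\<^sup>2 / (real j + 2)\<^sup>2"
  proof (cases "F (z (Suc j)) - F u \<ge> 0")
    case True
    have "((real j + 2) / 2)\<^sup>2 * (F (z (Suc j)) - F u) \<le> (?t (Suc j))\<^sup>2 * (F (z (Suc j)) - F u)"
      by (intro mult_right_mono power_mono fista_seq_Suc_ge True) auto
    also have "\<dots> \<le> L / 2 * (norm (z 0 - u))\<^sup>2"
    proof -
      have "0 \<le> L / 2 * (norm (?a j))\<^sup>2" using \<open>L \<ge> 0\<close> by simp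
      with inv[of j] show ?thesis by linarith
    qed
    finally show ?thesis by (simp add: power_divide field_simps)
  next
    case False
    moreover have "0 \<le> 2 * L * (norm (z 0 - u))\<^sup>2 / (real j + 2)\<^sup>2"
      using \<open>L \<ge> 0\<close> by simp
    ultimately show ?thesis by linarith
  qed
  then show ?thesis by (simp add: F_def)
qed


section \<open>The objective and the inner method\<close>

lemma proper_closed_convex_real:
  assumes "proper_closed_convex f" "u \<in> effective_domain f"
  shows "f u = ereal (real_of_ereal (f u))"
  using assms by (cases "f u") (auto simp: proper_closed_convex_def effective_domain_def)

text \<open>On \<open>U\<close> the values are finite, so graph points lie in the epigraph, and its
  convexity contains the chord inequality.\<close>

lemma proper_closed_convex_convex_on:
  assumes f: "proper_closed_convex f" and U: "U \<subseteq> effective_domain f" "convex U"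
  shows "convex_on U (\<lambda>u. real_of_ereal (f u))"
proof (rule convex_onI)
  fix t :: real and x y assume t: "0 < t" "t < 1" and xy: "x \<in> U" "y \<in> U"
  let ?p = "\<lambda>u. real_of_ereal (f u)"
  have f_eq: "\<forall>u\<in>U. f u = ereal (?p u)"
    using proper_closed_convex_real[OF f] U by blast
  have "(1 - t) *\<^sub>R (x, ?p x) + t *\<^sub>R (y, ?p y) \<in> ereal_epigraph f"
    using f t f_eq xy
    by (intro convexD) (auto simp: proper_closed_convex_def ereal_epigraph_def)
  then have "f ((1 - t) *\<^sub>R x + t *\<^sub>R y) \<le> ereal ((1 - t) * ?p x + t * ?p y)"
    by (simp add: ereal_epigraph_def)
  moreover have "(1 - t) *\<^sub>R x + t *\<^sub>R y \<in> U"
    using U xy t by (intro convexD) auto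
  then have "f ((1 - t) *\<^sub>R x + t *\<^sub>R y) = ereal (?p ((1 - t) *\<^sub>R x + t *\<^sub>R y))"
    using f_eq by blast
  ultimately show "?p ((1 - t) *\<^sub>R x + t *\<^sub>R y) \<le> (1 - t) * ?p x + t * ?p y"
    by (metis ereal_less_eq(3))
qed (fact U(2))

text \<open>This replaces the extended-real infimum by real inequalities against each competitor;
  attainment is not involved, and the term in \<open>norm x\<close> cancels.\<close>

lemma inner_accepts_iff:
  assumes f_eq: "\<forall>u\<in>U. f u = ereal (p u)" and v: "v \<in> U"
  shows "inner_accepts f U G g K \<mu> \<delta> x v \<longleftrightarrow>
    (\<forall>u\<in>U. p v + aug_penalty G g K \<mu> x v \<le> p u + aug_penalty G g K \<mu> x u + \<delta>)"
proof -
  define A where "A u = p u + (aug_penalty G g K \<mu> x u - 1 / (2 * \<mu>) * (norm x)\<^sup>2)" for u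
  define b where "b = aug_dual f U G g K \<mu> x"
  have A: "aug_lagrangian f G g K \<mu> u x = ereal (A u)" if "u \<in> U" for u
    using that by (simp add: aug_lagrangian_def A_def f_eq)
  have b: "b = (INF u\<in>U. ereal (A u))"
    unfolding b_def aug_dual_def by (intro INF_cong A refl)
  then have "b \<le> ereal (A v)" using v by (auto intro: INF_lower)
  then have "inner_accepts f U G g K \<mu> \<delta> x v \<longleftrightarrow> ereal (A v - \<delta>) \<le> b"
    unfolding inner_accepts_def b_def[symmetric] A[OF v] by (cases b) auto
  also have "\<dots> \<longleftrightarrow> (\<forall>u\<in>U. A v - \<delta> \<le> A u)"
    unfolding b le_INF_iff by simp
  also have "\<dots> \<longleftrightarrow>
      (\<forall>u\<in>U. p v + aug_penalty G g K \<mu> x v \<le> p u + aug_penalty G g K \<mu> x u + \<delta>)"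
    by (intro ball_cong refl) (auto simp: A_def)
  finally show ?thesis .
qed

lemma inner_run_mem: "inner_run simple Lf f U G g K \<mu> x z w \<Longrightarrow> z j \<in> U"
  by (auto simp: inner_run_def intro: accelerated_run_mem split: if_splits)

section \<open>Termination and cost of one inner run\<close>

text \<open>Both variants split the same objective with the same constant \<open>L\<close>, up to an
  additive constant, so one rate covers them; bounding the initial distance by \<open>D_U\<close>
  then gives accuracy \<delta>.\<close>

lemma inner_run_accepts:
  fixes f :: "real^'n \<Rightarrow> ereal"
  assumes f: "proper_closed_convex f" and U: "U \<subseteq> effective_domain f" "convex U"
    and K: "K \<noteq> {}" "closed K" "convex K"
    and f_simple: "simple \<Longrightarrow> L_f = 0"
    and f_smooth: "\<not> simple \<Longrightarrow>
      effective_domain f = UNIV \<and> L_f > 0 \<and> lipschitz_gradient L_f f"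
    and "\<mu> \<ge> 0" and L: "L = L_f + \<mu> * (onorm ((*v) G))\<^sup>2"
    and run: "inner_run simple L_f f U G g K \<mu> x z w"
    and D_U: "\<And>u. u \<in> U \<Longrightarrow> norm (z 0 - u) \<le> D_U"
    and j: "2 * L * D_U\<^sup>2 \<le> \<delta> * (real j + 2)\<^sup>2"
  shows "inner_accepts f U G g K \<mu> \<delta> x (z (Suc j))"
proof -
  let ?p = "\<lambda>u. real_of_ereal (f u)" and ?P = "aug_penalty G g K \<mu> x"
  have f_eq: "\<forall>u\<in>U. f u = ereal (?p u)"
    using proper_closed_convex_real[OF f] U by blast
  have "L_f \<ge> 0" using f_simple f_smooth by (cases simple) auto
  then have L0: "L \<ge> 0" using \<open>\<mu> \<ge> 0\<close> by (simp add: L)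
  obtain D where D: "smooth_convex ?P D (\<mu> * (onorm ((*v) G))\<^sup>2)"
    using smooth_convex_aug_penalty[OF K(2,3,1) \<open>\<mu> \<ge> 0\<close>] .
  have rate: "?p (z (Suc j)) + ?P (z (Suc j))
      \<le> ?p u + ?P u + 2 * L * (norm (z 0 - u))\<^sup>2 / (real j + 2)\<^sup>2" if u: "u \<in> U" for u
  proof (cases simple)
    case True
    then have "accelerated_run U ?P f L z w"
      using run f_simple by (simp add: inner_run_def L)
    moreover have "smooth_convex ?P D L"
      using D f_simple True by (simp add: L)
    ultimately show ?thesis
      using accelerated_run_bound[of U ?P f L z w D ?p u j] L0 f_eq u
        proper_closed_convex_convex_on[OF f U] by (simp add: add.commute)
  next
    case False
    with f_smooth have dom: "effective_domain f = UNIV" and lip: "lipschitz_gradient L_f f"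
      by auto
    \<comment> \<open>Independent of \<open>u\<close>, this shift leaves gradients and objective
      gaps unchanged.\<close>
    define c where "c = - (1 / (2 * \<mu>) * (norm x)\<^sup>2)"
    have "GDERIV ?p a :> gradient ?p a" for a
      using lip gradient_eqI unfolding lipschitz_gradient_def by metis
    then have "smooth_convex ?p (gradient ?p) L_f"
      using lip proper_closed_convex_convex_on[OF f, of UNIV]
      by (intro smooth_convex_lipschitz_gradient) (auto simp: lipschitz_gradient_def dom)
    from smooth_convex_add_const[OF smooth_convex_add[OF this D], of c]
    have sc: "smooth_convex (\<lambda>u. ?p u + ?P u + c) (\<lambda>u. gradient ?p u + D u) L"
      by (simp add: L)
    have "real_of_ereal (aug_lagrangian f G g K \<mu> u x) = ?p u + ?P u + c" for u
      using proper_closed_convex_real[OF f, of u] dom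
      by (cases "f u") (auto simp: aug_lagrangian_def c_def)
    then have "accelerated_run U (\<lambda>u. ?p u + ?P u + c) (\<lambda>_. 0) L z w"
      using run False by (simp add: inner_run_def L)
    from accelerated_run_bound[OF this sc L0, of "\<lambda>_. 0" u j] u U(2)
    show ?thesis by (simp add: zero_ereal_def convex_on_const)
  qed
  show ?thesis
    unfolding inner_accepts_iff[where p = ?p, OF f_eq inner_run_mem[OF run]]
  proof
    fix u assume u: "u \<in> U"
    have "2 * L * (norm (z 0 - u))\<^sup>2 \<le> 2 * L * D_U\<^sup>2"
      using L0 D_U[OF u] by (intro mult_left_mono power_mono) auto
    also note j
    finally have "2 * L * (norm (z 0 - u))\<^sup>2 / (real j + 2)\<^sup>2 \<le> \<delta>"
      by (simp add: divide_le_eq)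
    with rate[OF u] show "?p (z (Suc j)) + ?P (z (Suc j)) \<le> ?p u + ?P u + \<delta>"
      by linarith
  qed
qed

lemma inner_run_count:
  fixes f :: "real^'n \<Rightarrow> ereal"
  assumes f: "proper_closed_convex f" and U: "U \<subseteq> effective_domain f" "convex U"
    and K: "K \<noteq> {}" "closed K" "convex K"
    and f_simple: "simple \<Longrightarrow> L_f = 0"
    and f_smooth: "\<not> simple \<Longrightarrow>
      effective_domain f = UNIV \<and> L_f > 0 \<and> lipschitz_gradient L_f f"
    and "\<mu> \<ge> 0" and L: "L = L_f + \<mu> * (onorm ((*v) G))\<^sup>2" "L > 0" and "\<delta> > 0"
    and run: "inner_run simple L_f f U G g K \<mu> x z w"
    and D_U: "\<And>u. u \<in> U \<Longrightarrow> norm (z 0 - u) \<le> D_U"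
  shows "\<exists>j. inner_accepts f U G g K \<mu> \<delta> x (z j) \<and> int j \<le> \<lceil>D_U * sqrt (2 * L / \<delta>)\<rceil>"
proof (cases "D_U > 0")
  case True
  define X where "X = D_U * sqrt (2 * L / \<delta>)"
  have X: "X > 0" using True L \<open>\<delta> > 0\<close> by (simp add: X_def)
  \<comment> \<open>Chosen so that \<open>Suc j\<close> is the ceiling of \<open>X\<close>;
    positivity of \<open>X\<close> keeps the natural subtraction from truncating.\<close>
  define j where "j = nat \<lceil>X\<rceil> - 1"
  have ceil: "\<lceil>X\<rceil> = int (Suc j)" using X by (simp add: j_def)
  then have "X \<le> real j + 2" by linarith
  then have "X\<^sup>2 \<le> (real j + 2)\<^sup>2" using X by (intro power_mono) auto
  then have "\<delta> * X\<^sup>2 \<le> \<delta> * (real j + 2)\<^sup>2" using \<open>\<delta> > 0\<close> by simp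
  moreover have "\<delta> * X\<^sup>2 = 2 * L * D_U\<^sup>2"
    using L \<open>\<delta> > 0\<close> by (simp add: X_def power_mult_distrib)
  ultimately have "2 * L * D_U\<^sup>2 \<le> \<delta> * (real j + 2)\<^sup>2" by simp
  from inner_run_accepts[OF f U K f_simple f_smooth \<open>\<mu> \<ge> 0\<close> L(1) run D_U this]
  have "inner_accepts f U G g K \<mu> \<delta> x (z (Suc j))" .
  moreover have "int (Suc j) \<le> \<lceil>D_U * sqrt (2 * L / \<delta>)\<rceil>"
    using ceil by (simp add: X_def)
  ultimately show ?thesis by blast
next
  case False
  have f_eq: "\<forall>u\<in>U. f u = ereal (real_of_ereal (f u))"
    using proper_closed_convex_real[OF f] U by blast
  have z0: "z 0 \<in> U" using run by (rule inner_run_mem)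
  \<comment> \<open>The allowed count is now 0, so the starting point itself must be accepted; it is
    the only point of \<open>U\<close>.\<close>
  have "D_U = 0" using D_U[OF z0] False by simp
  moreover from this have "z 0 = u" if "u \<in> U" for u using D_U[OF that] by simp
  then have "inner_accepts f U G g K \<mu> \<delta> x (z 0)"
    unfolding inner_accepts_iff[where p = "\<lambda>u. real_of_ereal (f u)", OF f_eq z0] using \<open>\<delta> > 0\<close>
    by (metis add_le_cancel_left add_0_right less_imp_le)
  ultimately show ?thesis by (intro exI[of _ 0]) simp
qed


section \<open>Accuracy of a penalty minimizer\<close>

lemma penalty_minimizer_accuracy:
  fixes f :: "real^'n \<Rightarrow> ereal"
  assumes f_eq: "\<forall>u\<in>U. f u = ereal (p u)"
    and K: "K \<noteq> {}" "closed K"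
    and xstar: "lagrange_multiplier f U G g K xstar" and R: "R = norm xstar" "R > 1"
    and \<epsilon>: "\<epsilon> > 0"
    and v: "v \<in> U" "inner_accepts f U G g K (16 * R\<^sup>2 / \<epsilon>) (\<epsilon> / 24) 0 v"
  shows "\<bar>f v - opt_val f U G g K\<bar> \<le> ereal \<epsilon>" "proj_dist K (G *v v + g) \<le> \<epsilon>"
proof -
  let ?b = "G *v v + g"
  define q where "q = proj_dist K ?b"
  define r where "r = opt_val f U G g K"
  have q0: "q \<ge> 0" by (simp add: q_def proj_dist_def)
  \<comment> \<open>Feasible points carry zero penalty at multiplier 0, so acceptance compares
    \<open>v\<close> directly with their objective values.\<close>
  have lower: "ereal (p v + 8 * R\<^sup>2 / \<epsilon> * q\<^sup>2 - \<epsilon> / 24) \<le> r"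
    unfolding r_def opt_val_def
  proof (rule INF_greatest)
    fix u assume u: "u \<in> {u \<in> U. G *v u + g \<in> K}"
    then have "aug_penalty G g K (16 * R\<^sup>2 / \<epsilon>) 0 u = 0"
      by (simp add: aug_penalty_def proj_dist_def closest_point_self)
    moreover have "aug_penalty G g K (16 * R\<^sup>2 / \<epsilon>) 0 v = 8 * R\<^sup>2 / \<epsilon> * q\<^sup>2"
      by (simp add: aug_penalty_def q_def)
    moreover have "p v + aug_penalty G g K (16 * R\<^sup>2 / \<epsilon>) 0 v
        \<le> p u + aug_penalty G g K (16 * R\<^sup>2 / \<epsilon>) 0 u + \<epsilon> / 24"
      using v(2) u unfolding inner_accepts_iff[OF f_eq v(1)] by blast
    ultimately show "ereal (p v + 8 * R\<^sup>2 / \<epsilon> * q\<^sup>2 - \<epsilon> / 24) \<le> f u"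
      using u f_eq by simp
  qed
  \<comment> \<open>The dual function at \<open>xstar\<close> is tested with \<open>v\<close> and
    the projection of its constraint value onto \<open>K\<close>; Cauchy-Schwarz bounds the inner
    product.\<close>
  have upper: "r \<le> ereal (p v + R * q)"
  proof -
    have "closest_point K ?b \<in> K" using K by (intro closest_point_in_set)
    then have "(v, closest_point K ?b) \<in> U \<times> K" using v by simp
    then have "r \<le> (case (v, closest_point K ?b) of
        (u, s) \<Rightarrow> f u + ereal (inner xstar (G *v u + g - s)))"
      using xstar unfolding r_def lagrange_multiplier_def dual_fun_def
      by (metis (no_types, lifting) INF_lower)
    also have "\<dots> \<le> ereal (p v + R * q)"
      using norm_cauchy_schwarz[of xstar "?b - closest_point K ?b"]
      by (simp add: f_eq v(1) R q_def proj_dist_def)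
    finally show ?thesis .
  qed
  \<comment> \<open>Real bounds on both sides make the optimal value finite, which also excludes
    infeasibility.\<close>
  from lower upper obtain r' where r': "r = ereal r'" by (cases r) auto
  \<comment> \<open>In this scaling \<epsilon> drops out and the two bounds combine to
    \<open>8 * s\<^sup>2 \<le> 1 / 24 + s\<close>, which fails for \<open>s > 1\<close>.\<close>
  define s where "s = R * q / \<epsilon>"
  have s0: "s \<ge> 0" using q0 R \<epsilon> by (simp add: s_def)
  have Rq: "R * q = \<epsilon> * s" using \<epsilon> by (simp add: s_def)
  have "8 * R\<^sup>2 / \<epsilon> * q\<^sup>2 = \<epsilon> * (8 * s\<^sup>2)"
    using \<epsilon> by (simp add: s_def power2_eq_square field_simps)
  with lower upper have le: "p v + \<epsilon> * (8 * s\<^sup>2) - \<epsilon> / 24 \<le> r'" "r' \<le> p v + \<epsilon> * s"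
    by (simp_all add: r' Rq)
  then have "\<epsilon> * (8 * s\<^sup>2) \<le> \<epsilon> * (1 / 24 + s)"
    by (simp add: distrib_left)
  then have quad: "8 * s\<^sup>2 \<le> 1 / 24 + s" using \<epsilon> by simp
  have "s \<le> 1"
  proof (rule ccontr)
    assume "\<not> s \<le> 1"
    then have "s * 1 \<le> s * s" by (intro mult_left_mono) auto
    with quad \<open>\<not> s \<le> 1\<close> show False by (simp add: power2_eq_square)
  qed
  then have s1: "\<epsilon> * s \<le> \<epsilon>" using \<epsilon> by simp
  \<comment> \<open>Here \<open>R > 1\<close> passes from the weighted residual to the residual
    itself.\<close>
  have "q \<le> R * q" using q0 R by (simp add: mult_le_cancel_right1)
  with Rq s1 show "proj_dist K ?b \<le> \<epsilon>" by (simp add: q_def)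
  have "0 \<le> \<epsilon> * (8 * s\<^sup>2)" using \<epsilon> by simp
  with le s1 \<epsilon> have "\<bar>p v - r'\<bar> \<le> \<epsilon>" by linarith
  then show "\<bar>f v - opt_val f U G g K\<bar> \<le> ereal \<epsilon>"
    by (simp add: f_eq v(1) r_def[symmetric] r')
qed

section \<open>Assembly at outer index 2\<close>

text \<open>The average stops at index \<open>k - 1\<close>, so for \<open>k = 2\<close> only the
  first iterate enters, with weight 1.\<close>

lemma weighted_avg_2: "weighted_avg u 2 = u 1"
  by (simp add: weighted_avg_def)

theorem theorem3p8:
  fixes f :: "real^'n \<Rightarrow> ereal" and U :: "(real^'n) set"
    and G :: "real^'n^'m" and g :: "real^'m" and K :: "(real^'m) set"
    and xstar :: "real^'m" and D_U R_d L_f :: real and simple :: bool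
  assumes f: "proper_closed_convex f"
    and U: "U \<subseteq> effective_domain f" "U \<noteq> {}" "closed U" "convex U" "bounded U"
    and D_U: "\<And>u v. u \<in> U \<Longrightarrow> v \<in> U \<Longrightarrow> norm (u - v) \<le> D_U"
    and G: "G \<noteq> 0"
    and K: "K \<noteq> {}" "closed K" "convex K" "cone K"
    and xstar: "lagrange_multiplier f U G g K xstar"
    and R_d: "R_d = norm xstar" "R_d > 1"
    and f_simple: "simple \<Longrightarrow> simple_on U f \<and> L_f = 0"
    and f_smooth: "\<not> simple \<Longrightarrow>
      effective_domain f = UNIV \<and> L_f > 0 \<and> lipschitz_gradient L_f f"
  shows "\<forall>\<^sub>F \<epsilon> in at_right (0::real).
    \<forall>\<mu> \<delta> L_d x y u z w.
      \<mu> = 16 * R_d\<^sup>2 / \<epsilon> \<longrightarrow> \<delta> = \<epsilon> / 24 \<longrightarrow> L_d = 1 / \<mu> \<longrightarrow>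
      outer_run simple L_f f U G g K \<mu> \<delta> L_d x y u z w \<longrightarrow>
      (\<exists>k\<ge>2.
         \<bar>f (weighted_avg u k) - opt_val f U G g K\<bar> \<le> ereal \<epsilon> \<and>
         proj_dist K (G *v weighted_avg u k + g) \<le> \<epsilon> \<and>
         (\<forall>i\<in>{1..k-1}. \<exists>j. inner_accepts f U G g K \<mu> \<delta> (y i) (z i j)) \<and>
         int (\<Sum>i=1..k-1. inner_count f U G g K \<mu> \<delta> (y i) (z i))
           \<le> \<lceil>14 * sqrt L_f * D_U / sqrt \<epsilon> + 56 * R_d * onorm ((*v) G) * D_U / \<epsilon>\<rceil>)"
\<comment> \<open>An explicit right neighbourhood of 0 is fixed; its upper end 1 is an arbitrary
  choice.\<close>
proof (rule eventually_at_rightI[of 0 1], intro allI impI)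
  fix \<epsilon> :: real and \<mu> \<delta> L_d :: real and x y u z w
  assume "\<epsilon> \<in> {0<..<1}" and \<mu>: "\<mu> = 16 * R_d\<^sup>2 / \<epsilon>" and \<delta>: "\<delta> = \<epsilon> / 24"
    and run: "outer_run simple L_f f U G g K \<mu> \<delta> L_d x y u z w"
  then have \<epsilon>: "\<epsilon> > 0" by simp
  have y1: "y 1 = 0" and inner: "inner_run simple L_f f U G g K \<mu> 0 (z 1) (w 1)"
    and u1: "u 1 = z 1 (inner_count f U G g K \<mu> \<delta> 0 (z 1))"
    using run by (auto simp: outer_run_def)
  have f_eq: "\<forall>u\<in>U. f u = ereal (real_of_ereal (f u))"
    using proper_closed_convex_real[OF f] U(1) by blast
  have Lf0: "L_f \<ge> 0" using f_simple f_smooth by (cases simple) auto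
  have D0: "D_U \<ge> 0" using U(2) D_U norm_ge_zero order_trans by blast
  have "onorm ((*v) G) > 0"
    using G by (auto simp: onorm_pos_lt[OF matrix_vector_mul_bounded_linear] matrix_eq)
  define L where "L = L_f + \<mu> * (onorm ((*v) G))\<^sup>2"
  have \<mu>0: "\<mu> > 0" unfolding \<mu> using R_d(2) \<epsilon> by (intro divide_pos_pos mult_pos_pos zero_less_power) auto
  then have L0: "L > 0" using Lf0 \<open>onorm _ > 0\<close> by (simp add: L_def add_nonneg_pos)
  have "\<delta> > 0" using \<epsilon> by (simp add: \<delta>)
  have z0: "z 1 0 \<in> U" using inner by (rule inner_run_mem)
  obtain j where j: "inner_accepts f U G g K \<mu> \<delta> 0 (z 1 j)"
      "int j \<le> \<lceil>D_U * sqrt (2 * L / \<delta>)\<rceil>"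
    using inner_run_count[OF f U(1,4) K(1-3) _ f_smooth _ L_def L0 \<open>\<delta> > 0\<close> inner D_U[OF z0]]
      f_simple \<mu>0 by auto
  \<comment> \<open>The index \<open>j\<close> shows that the least accepted index is genuine and
    bounds it; the method itself stops at that least index.\<close>
  have acc: "inner_accepts f U G g K \<mu> \<delta> 0 (u 1)"
    unfolding u1 inner_count_def using j(1) by (rule LeastI)
  have uU: "u 1 \<in> U" unfolding u1 using inner by (rule inner_run_mem)
  have count: "inner_count f U G g K \<mu> \<delta> 0 (z 1) \<le> j"
    unfolding inner_count_def using j(1) by (rule Least_le)
  have bound: "D_U * sqrt (2 * L / \<delta>)
      \<le> 14 * sqrt L_f * D_U / sqrt \<epsilon> + 56 * R_d * onorm ((*v) G) * D_U / \<epsilon>"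
  proof -
    \<comment> \<open>The parameters give
      \<open>2 * L / \<delta> = 48 * A\<^sup>2 + 768 * B\<^sup>2\<close>; since 48 \<le> 14^2 and
      768 \<le> 56^2, the square of \<open>14 * A + 56 * B\<close> dominates it.\<close>
    define A B where "A = sqrt L_f / sqrt \<epsilon>" and "B = R_d * onorm ((*v) G) / \<epsilon>"
    have AB: "A \<ge> 0" "B \<ge> 0" using Lf0 \<epsilon> R_d \<open>onorm _ > 0\<close> by (simp_all add: A_def B_def)
    have "2 * L / \<delta> = 48 * A\<^sup>2 + 768 * B\<^sup>2"
      using Lf0 \<epsilon> by (simp add: L_def \<mu> \<delta> A_def B_def power_divide power_mult_distrib
          power2_eq_square field_simps)
    also have "\<dots> \<le> (14 * A + 56 * B)\<^sup>2"
      using AB by (simp add: power2_eq_square algebra_simps)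
    finally have "sqrt (2 * L / \<delta>) \<le> 14 * A + 56 * B"
      using AB by (intro real_le_lsqrt) auto
    from mult_left_mono[OF this D0] show ?thesis
      by (simp add: A_def B_def algebra_simps)
  qed
  have "int (inner_count f U G g K \<mu> \<delta> 0 (z 1))
      \<le> \<lceil>14 * sqrt L_f * D_U / sqrt \<epsilon> + 56 * R_d * onorm ((*v) G) * D_U / \<epsilon>\<rceil>"
    using count j(2) ceiling_mono[OF bound] by linarith
  with penalty_minimizer_accuracy[where p = "\<lambda>v. real_of_ereal (f v)", OF f_eq K(1,2) xstar R_d \<epsilon> uU] acc j(1)
  show "\<exists>k\<ge>2.
         \<bar>f (weighted_avg u k) - opt_val f U G g K\<bar> \<le> ereal \<epsilon> \<and>
         proj_dist K (G *v weighted_avg u k + g) \<le> \<epsilon> \<and>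
         (\<forall>i\<in>{1..k-1}. \<exists>j. inner_accepts f U G g K \<mu> \<delta> (y i) (z i j)) \<and>
         int (\<Sum>i=1..k-1. inner_count f U G g K \<mu> \<delta> (y i) (z i))
           \<le> \<lceil>14 * sqrt L_f * D_U / sqrt \<epsilon> + 56 * R_d * onorm ((*v) G) * D_U / \<epsilon>\<rceil>"
    using y1 by (intro exI[of _ 2]) (auto simp: weighted_avg_2 \<mu> \<delta>)
qed simp

end
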